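(* Let $\alpha\ge 1$ be an integer and let $r\in(0,R]$. Let $\mathbf X$ be a stationary and isotropic pairwise interaction point process in $\mathbb R^d$ with Papangelou conditional intensity $$\lambda(u,\mathbf x)=\beta^\star\exp\Big(-\sum_{v\in\mathbf x\setminus u}\gamma(\|v-u\|)\Big),\qquad u\in\mathbb R^d,\ \mathbf x\in N_{lf},$$ where $\gamma(t)=0$ whenever $t>R$. Suppose that the kernel $K_1$ and the bandwidths $(b_n)$ satisfy Condition $K(1,\alpha)$ (defined in the context), and that the function $t\mapsto J(t)\exp(-\gamma(t))$ has bounded and continuous derivatives of order $\alpha$ in $(r-\delta,r+\delta)$ for some $\delta>0$. Then, as $n\to\infty$, $$\widehat\varPhi_n(r)\longrightarrow \exp(-\gamma(r))\quad\text{in probability }\mathbb P\ \ (\text{resp. }\mathbb P\text{-a.s.})$$ if and only if $$\widehat R_n(r)\longrightarrow \beta^{\star 2}J(r)\exp(-\gamma(r))\quad\text{in probability }\mathbb P\ \ (\text{resp. }\mathbb P\text{-a.s.}).$$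
   Context: $N_{lf}$ is the space of locally finite point configurations in $\mathbb R^d$; $\|\cdot\|$ is the Euclidean norm; $|W|$ is the Lebesgue measure of a bounded Borel set $W$; $o$ is the origin; $\sigma_d=2\pi^{d/2}/\Gamma(d/2)$ is the surface measure of the unit sphere $\mathbb S^{d-1}$. Integrals $\int_{\mathbb S^{d-1}}\cdots\,\mathrm dv$ are with respect to the normalized (probability) uniform measure on the sphere, so that $\int_{\mathbb R^d}f(u)\,\mathrm du=\int_0^\infty\int_{\mathbb S^{d-1}}f(tz)\,t^{d-1}\sigma_d\,\mathrm dt\,\mathrm dz$. A point process $\mathbf X$ (with law $\mathbb P$) has Papangelou conditional intensity $\lambda$ if $E\sum_{u\in\mathbf X}h(u,\mathbf X\setminus\{u\})=\int_{\mathbb R^d}E[h(u,\mathbf X)\lambda(u,\mathbf X)]\,\mathrm du$ for all non-negative measurable $h$. Here $\beta^\star>0$, $0<R<\infty$ is the interaction range, and it is assumed throughout that $\gamma(t)>0$ for $t\le R$. The process is stationary and isotropic. Put $d(u,\mathbf x)=\inf_{v\in\mathbf x}\|v-u\|$, $\widetilde h(u,\mathbf x)=\mathbf 1(d(u,\mathbf x)>R)$, $\widetilde F(o,tv)=E[\widetilde h(o,\mathbf X)\widetilde h(tv,\mathbf X)]$ and $J(t)=\int_{\mathbb S^{d-1}}\widetilde F(o,tv)\,\mathrm dv$. A single realization of $\mathbf X$ is observed in $W_n$, where $(W_n)_{n\ge1}$ is a sequence of cubes growing up to $\mathbb R^d$. For $s>0$, $W_{n\ominus s}=\{u\in W_n: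 B(u,s)\subset W_n\}$ denotes the $s$-interior of $W_n$ (Minkowski subtraction of a ball), with $|W_{n\ominus 2R}|>0$. The sign $\sum^{\neq}$ means summation over distinct pairs (ordered pairs $(u,v)$ with $u\ne v$). Condition $K(1,\alpha)$: the bandwidths $b_n>0$ satisfy $\lim_n b_n=0$ and $\lim_n b_n|W_{n\ominus 2R}|=\infty$; the kernel $K_1:\mathbb R\to\mathbb R$ is non-negative, bounded, with bounded support, $\int_{\mathbb R}K_1(u)\,\mathrm du=1$, and $\int_{\mathbb R}u^jK_1(u)\,\mathrm du=0$ for $j=1,\dots,\alpha-1$ (no moment condition when $\alpha=1$). Estimators: $$\widehat R_n(r)=\frac{1}{b_n|W_{n\ominus 2R}|\sigma_d}\sum_{u,v\in\mathbf X,\ \|v-u\|\le R}^{\neq}\frac{\mathbf 1_{W_{n\ominus 2R}}(u)}{\|v-u\|^{d-1}}\,\widetilde h(u,\mathbf X\setminus\{u,v\})\,\widetilde h(v,\mathbf X\setminus\{u,v\})\,K_1\Big(\frac{\|v-u\|-r}{b_n}\Big),$$ $$\widehat J_n(r)=\frac{1}{|W_{n\ominus 2R}|}\sum_{u\in\mathbf X}\mathbf 1_{W_{n\ominus 2R}}(u)\,\widetilde h(u,\mathbf X\setminus\{u\})\,h^\star(u,\mathbf X\setminus\{u\}),\qquad h^\star(u,\mathbf x)=\int_{\mathbb S^{d-1}}\widetilde h(u+rv,\mathbf x)\,\mathrm dv,$$ $$\widehat\beta_n=\frac{\sum_{u\in\mathbf X}\mathbf 1_{W_{n\ominus R}}(u)\,\widetilde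 h(u,\mathbf X\setminus\{u\})}{\int_{W_{n\ominus R}}\widetilde h(u,\mathbf X)\,\mathrm du},\qquad \widehat\varPhi_n(r)=\frac{\widehat R_n(r)}{\widehat\beta_n\,\widehat J_n(r)}.$$ Standing fact (recalled in the source from the spatial ergodic theorem and earlier work): $\widehat J_n(r)\to\beta^\star J(r)$ and $\widehat\beta_n\to\beta^\star$ $\mathbb P$-a.s. as $n\to\infty$. *)

theory Defs
  imports "HOL-Probability.Probability"
begin

definition N_lf :: "(real ^ 'd) set set" where
  "N_lf = {x. \<forall>B. bounded B \<longrightarrow> finite (x \<inter> B)}"

definition N_lf_algebra :: "(real ^ 'd) set measure" where
  "N_lf_algebra =
     sigma N_lf {{x \<in> N_lf. card (x \<inter> B) = k} | B k. B \<in> sets borel \<and> bounded B}"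

definition point_process :: "'w measure \<Rightarrow> ('w \<Rightarrow> (real ^ 'd) set) \<Rightarrow> bool" where
  "point_process M X \<longleftrightarrow> prob_space M \<and> X \<in> measurable M N_lf_algebra"

definition stationary :: "'w measure \<Rightarrow> ('w \<Rightarrow> (real ^ 'd) set) \<Rightarrow> bool" where
  "stationary M X \<longleftrightarrow>
     (\<forall>a. distr M N_lf_algebra (\<lambda>\<omega>. (\<lambda>v. v + a) ` X \<omega>) = distr M N_lf_algebra X)"

definition isotropic :: "'w measure \<Rightarrow> ('w \<Rightarrow> (real ^ 'd) set) \<Rightarrow> bool" where
  "isotropic M X \<longleftrightarrow>
     (\<forall>Q. rotation_matrix Q \<longrightarrow>
        distr M N_lf_algebra (\<lambda>\<omega>. (\<lambda>v. Q *v v) ` X \<omega>) = distr M N_lf_algebra X)"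

definition papangelou ::
  "'w measure \<Rightarrow> ('w \<Rightarrow> (real ^ 'd) set) \<Rightarrow> (real ^ 'd \<Rightarrow> (real ^ 'd) set \<Rightarrow> real) \<Rightarrow> bool" where
  "papangelou M X l \<longleftrightarrow>
     (\<forall>u. \<forall>x\<in>N_lf. 0 \<le> l u x) \<and>
     (\<lambda>(u, x). l u x) \<in> borel_measurable (borel \<Otimes>\<^sub>M N_lf_algebra) \<and>
     (\<forall>h :: real ^ 'd \<Rightarrow> (real ^ 'd) set \<Rightarrow> ennreal.
        (\<lambda>(u, x). h u x) \<in> borel_measurable (borel \<Otimes>\<^sub>M N_lf_algebra) \<longrightarrow>
        (\<integral>\<^sup>+ \<omega>. (\<integral>\<^sup>+ u. h u (X \<omega> - {u}) \<partial>count_space (X \<omega>)) \<partial>M) =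
        (\<integral>\<^sup>+ u. (\<integral>\<^sup>+ \<omega>. h u (X \<omega>) * ennreal (l u (X \<omega>)) \<partial>M) \<partial>lborel))"

text \<open>
  The sum over the (in general infinite) configuration is an \<^const>\<open>infsum\<close>: it has finitely
  many nonzero terms as soon as the interaction has finite range, whereas \<^const>\<open>sum\<close>
  would be 0 on an infinite index set.  The same remark applies to the estimators.
\<close>

definition pairwise_intensity ::
  "real \<Rightarrow> (real \<Rightarrow> real) \<Rightarrow> real ^ 'd \<Rightarrow> (real ^ 'd) set \<Rightarrow> real" where
  "pairwise_intensity \<beta> \<gamma> u x = \<beta> * exp (- (\<Sum>\<^sub>\<infinity>v\<in>x - {u}. \<gamma> (norm (v - u))))"

text \<open>
  The uniform probability measure on the unit sphere, as a Borel measure on the ambient space: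
  the law of \<open>x / norm x\<close> for \<open>x\<close> uniform in the unit ball.  This is the measure for which
  integration in polar coordinates holds with the constant \<open>\<sigma>\<^sub>d\<close>.
\<close>

definition sphere_measure :: "(real ^ 'd) measure" where
  "sphere_measure = distr (uniform_measure lborel (ball 0 1)) borel sgn"

lemma prob_space_sphere_measure: "prob_space (sphere_measure :: (real ^ 'd) measure)"
proof -
  have "emeasure lborel (ball 0 1 :: (real ^ 'd) set) \<noteq> 0"
    using content_ball_pos[of 1 "0 :: real ^ 'd"]
    by (simp add: measure_def) (metis enn2real_0 less_irrefl)
  then have "prob_space (uniform_measure lborel (ball 0 1 :: (real ^ 'd) set))"
    using emeasure_lborel_ball_finite[of "0 :: real ^ 'd" 1]
    by (intro prob_space_uniform_measure) auto
  then show ?thesis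
    unfolding sphere_measure_def by (rule prob_space.prob_space_distr) simp
qed

lemma AE_sphere_measure: "AE v in (sphere_measure :: (real ^ 'd) measure). norm v = 1"
proof -
  have "AE u in lborel. (u :: real ^ 'd) \<noteq> 0"
    by (rule AE_lborel_singleton)
  then have "AE u in uniform_measure lborel (ball 0 1 :: (real ^ 'd) set). u \<noteq> 0"
    by (intro AE_uniform_measureI) auto
  then show ?thesis
    unfolding sphere_measure_def by (subst AE_distr_iff) (auto simp: norm_sgn)
qed

definition sphere_area :: "'d::finite itself \<Rightarrow> real" where
  "sphere_area _ = 2 * pi powr (real CARD('d) / 2) / Gamma (real CARD('d) / 2)"

lemma sphere_area_eq: "sphere_area TYPE('d::finite) = CARD('d) * unit_ball_vol CARD('d)"
proof -
  define x where "x = real CARD('d) / 2"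
  have x: "x > 0"
    by (simp add: x_def)
  have "Gamma (x + 1) = x * Gamma x" and "Gamma x > 0"
    using x Gamma_real_pos[of x] by (auto intro!: Gamma_plus1 elim!: nonpos_Ints_cases)
  moreover have "real CARD('d) = 2 * x"
    by (simp add: x_def)
  ultimately show ?thesis
    using x by (simp add: sphere_area_def unit_ball_vol_def)
qed

text \<open>
  Extended reals give the infimum over the empty configuration its value \<open>\<infinity>\<close>
  (\<^const>\<open>infdist\<close> would give 0).
\<close>

definition conf_dist :: "real ^ 'd \<Rightarrow> (real ^ 'd) set \<Rightarrow> ereal" where
  "conf_dist u x = (INF v\<in>x. ereal (norm (v - u)))"

definition h_tilde :: "real \<Rightarrow> real ^ 'd \<Rightarrow> (real ^ 'd) set \<Rightarrow> real" where
  "h_tilde R u x = of_bool (conf_dist u x > ereal R)"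

definition F_tilde ::
  "'w measure \<Rightarrow> ('w \<Rightarrow> (real ^ 'd) set) \<Rightarrow> real \<Rightarrow> real ^ 'd \<Rightarrow> real ^ 'd \<Rightarrow> real" where
  "F_tilde M X R u v = (\<integral>\<omega>. h_tilde R u (X \<omega>) * h_tilde R v (X \<omega>) \<partial>M)"

definition J_fun :: "'w measure \<Rightarrow> ('w \<Rightarrow> (real ^ 'd) set) \<Rightarrow> real \<Rightarrow> real \<Rightarrow> real" where
  "J_fun M X R t = (\<integral>v. F_tilde M X R 0 (t *\<^sub>R v) \<partial>sphere_measure)"

definition h_star :: "real \<Rightarrow> real \<Rightarrow> real ^ 'd \<Rightarrow> (real ^ 'd) set \<Rightarrow> real" where
  "h_star R r u x = (\<integral>v. h_tilde R (u + r *\<^sub>R v) x \<partial>sphere_measure)"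

definition is_cube :: "(real ^ 'd) set \<Rightarrow> bool" where
  "is_cube W \<longleftrightarrow> (\<exists>c a. 0 < a \<and> W = {u. \<forall>i. \<bar>u $ i - c $ i\<bar> \<le> a})"

definition growing_cubes :: "(nat \<Rightarrow> (real ^ 'd) set) \<Rightarrow> bool" where
  "growing_cubes W \<longleftrightarrow> (\<forall>n. is_cube (W n)) \<and> incseq W \<and> (\<Union>n. W n) = UNIV"

definition erode :: "(real ^ 'd) set \<Rightarrow> real \<Rightarrow> (real ^ 'd) set" where
  "erode W s = {u \<in> W. cball u s \<subseteq> W}"

definition vol :: "(real ^ 'd) set \<Rightarrow> real" where
  "vol W = measure lborel W"

definition kernel_condition ::
  "nat \<Rightarrow> (real \<Rightarrow> real) \<Rightarrow> (nat \<Rightarrow> real) \<Rightarrow> (nat \<Rightarrow> (real ^ 'd) set) \<Rightarrow> real \<Rightarrow> bool" where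
  "kernel_condition \<alpha> K b W R \<longleftrightarrow>
     (\<forall>n. 0 < b n) \<and> b \<longlonglongrightarrow> 0 \<and>
     filterlim (\<lambda>n. b n * vol (erode (W n) (2 * R))) at_top sequentially \<and>
     (\<forall>t. 0 \<le> K t) \<and> bounded (range K) \<and> bounded {t. K t \<noteq> 0} \<and>
     has_bochner_integral lborel K 1 \<and>
     (\<forall>j\<in>{1..<\<alpha>}. has_bochner_integral lborel (\<lambda>t. t ^ j * K t) 0)"

definition R_hat ::
  "(real \<Rightarrow> real) \<Rightarrow> real \<Rightarrow> real \<Rightarrow> (real ^ 'd) set \<Rightarrow> real \<Rightarrow> (real ^ 'd) set \<Rightarrow> real" where
  "R_hat K R b W r x =
     1 / (b * vol (erode W (2 * R)) * sphere_area TYPE('d)) *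
     (\<Sum>\<^sub>\<infinity>(u, v)\<in>{(u, v). u \<in> x \<and> v \<in> x \<and> u \<noteq> v \<and> norm (v - u) \<le> R}.
        indicator (erode W (2 * R)) u / norm (v - u) ^ (CARD('d) - 1) *
        h_tilde R u (x - {u, v}) * h_tilde R v (x - {u, v}) *
        K ((norm (v - u) - r) / b))"

definition J_hat ::
  "real \<Rightarrow> (real ^ 'd) set \<Rightarrow> real \<Rightarrow> (real ^ 'd) set \<Rightarrow> real" where
  "J_hat R W r x =
     1 / vol (erode W (2 * R)) *
     (\<Sum>\<^sub>\<infinity>u\<in>x. indicator (erode W (2 * R)) u * h_tilde R u (x - {u}) * h_star R r u (x - {u}))"

definition beta_hat :: "real \<Rightarrow> (real ^ 'd) set \<Rightarrow> (real ^ 'd) set \<Rightarrow> real" where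
  "beta_hat R W x =
     (\<Sum>\<^sub>\<infinity>u\<in>x. indicator (erode W R) u * h_tilde R u (x - {u})) /
     (LINT u:erode W R|lborel. h_tilde R u x)"

definition Phi_hat ::
  "(real \<Rightarrow> real) \<Rightarrow> real \<Rightarrow> real \<Rightarrow> (real ^ 'd) set \<Rightarrow> real \<Rightarrow> (real ^ 'd) set \<Rightarrow> real" where
  "Phi_hat K R b W r x = R_hat K R b W r x / (beta_hat R W x * J_hat R W r x)"

definition bounded_continuous_derivative_on :: "nat \<Rightarrow> (real \<Rightarrow> real) \<Rightarrow> real set \<Rightarrow> bool" where
  "bounded_continuous_derivative_on k f S \<longleftrightarrow>
     (\<forall>j<k. \<forall>t\<in>S. (deriv ^^ j) f differentiable (at t)) \<and>
     continuous_on S ((deriv ^^ k) f) \<and> bounded ((deriv ^^ k) f ` S)"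

text \<open>
  Meant for random variables \<open>Y n\<close>: \<^const>\<open>measure\<close> is 0 on non-measurable sets.
\<close>

definition converges_in_prob ::
  "'w measure \<Rightarrow> (nat \<Rightarrow> 'w \<Rightarrow> real) \<Rightarrow> real \<Rightarrow> bool" where
  "converges_in_prob M Y c \<longleftrightarrow>
     (\<forall>\<epsilon>>0. (\<lambda>n. measure M {\<omega> \<in> space M. \<bar>Y n \<omega> - c\<bar> > \<epsilon>}) \<longlonglongrightarrow> 0)"

definition converges_as ::
  "'w measure \<Rightarrow> (nat \<Rightarrow> 'w \<Rightarrow> real) \<Rightarrow> real \<Rightarrow> bool" where
  "converges_as M Y c \<longleftrightarrow> (AE \<omega> in M. (\<lambda>n. Y n \<omega>) \<longlonglongrightarrow> c)"

end

theory Submission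
  imports Defs
begin

text \<open>
  The denominator of the estimator converges almost surely to \<open>\<beta>\<^sup>2 J(r)\<close>, so the equivalence is a
  Slutsky argument once \<open>J(r) > 0\<close>.  This holds because \<open>F(o, r v)\<close> is the probability that
  two balls of radius \<open>R\<close> contain no point, and the defining equation of the conditional
  intensity makes all void probabilities of bounded sets positive.  Since \<^const>\<open>measure\<close> vanishes on
  non-measurable sets, the statement in probability also needs the estimators to be measurable
  functions of the configuration.
\<close>

subsection \<open>Measurability on the space of configurations\<close>

lemma space_N_lf_algebra: "space N_lf_algebra = N_lf"
  unfolding N_lf_algebra_def by (rule space_measure_of) auto

lemma N_lf_finite_Int: "x \<in> N_lf \<Longrightarrow> bounded B \<Longrightarrow> finite (x \<inter> B)"
  by (simp add: N_lf_def)

lemma N_lf_Diff: "x \<in> N_lf \<Longrightarrow> x - A \<in> N_lf"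
  by (auto simp: N_lf_def Diff_Int_distrib2)

lemma measurable_card_Int:
  fixes B :: "(real ^ 'd) set"
  assumes "B \<in> sets borel" and "bounded B"
  shows "(\<lambda>x. card (x \<inter> B)) \<in> measurable N_lf_algebra (count_space UNIV)"
proof -
  have "{x \<in> N_lf. card (x \<inter> B) = k} \<in> sets N_lf_algebra" for k
    unfolding N_lf_algebra_def using assms by (intro in_measure_of) auto
  moreover have "(\<lambda>x. card (x \<inter> B)) -` {k} \<inter> space N_lf_algebra = {x \<in> N_lf. card (x \<inter> B) = k}" for k
    by (auto simp: space_N_lf_algebra)
  ultimately show ?thesis
    by (simp add: measurable_count_space_eq2_countable)
qed

lemma measurable_card_Int_compose:
  fixes B :: "(real ^ 'd) set"
  assumes "g \<in> measurable A N_lf_algebra" and "B \<in> sets borel" and "bounded B"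
  shows "(\<lambda>a. card (g a \<inter> B)) \<in> measurable A (count_space UNIV)"
  using measurable_compose[OF assms(1) measurable_card_Int[OF assms(2,3)]] .

text \<open>Counting events generate the sigma-algebra on configurations, so it is enough to control
  the counts in bounded Borel sets.\<close>

lemma measurable_N_lf_algebraI:
  fixes g :: "'a \<Rightarrow> (real ^ 'd) set"
  assumes "\<And>a. a \<in> space A \<Longrightarrow> g a \<in> N_lf"
    and "\<And>B. B \<in> sets borel \<Longrightarrow> bounded B \<Longrightarrow>
      (\<lambda>a. card (g a \<inter> B)) \<in> measurable A (count_space UNIV)"
  shows "g \<in> measurable A N_lf_algebra"
  unfolding N_lf_algebra_def
proof (rule measurable_measure_of)
  show "g \<in> space A \<rightarrow> N_lf"
    using assms(1) by auto
  fix Y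
  assume "Y \<in> {{x \<in> N_lf. card (x \<inter> B) = k} | (B :: (real ^ 'd) set) k. B \<in> sets borel \<and> bounded B}"
  then obtain B :: "(real ^ 'd) set" and k
    where B: "B \<in> sets borel" "bounded B" and Y: "Y = {x \<in> N_lf. card (x \<inter> B) = k}"
    by blast
  have "g -` Y \<inter> space A = (\<lambda>a. card (g a \<inter> B)) -` {k} \<inter> space A"
    using assms(1) by (auto simp: Y)
  then show "g -` Y \<inter> space A \<in> sets A"
    using measurable_sets[OF assms(2)[OF B], of "{k}"] by simp
qed auto

section \<open>Empty closed balls around a point\<close>

text \<open>Local finiteness leaves only finitely many points within distance \<open>R + 1\<close>
  of \<open>u\<close>, so the strict inequality between \<open>R\<close> and the distances holds
  with a uniform margin.\<close>

lemma N_lf_gap: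
  fixes x :: "(real ^ 'd) set"
  assumes "x \<in> N_lf" and "x \<inter> cball u R = {}"
  obtains m where "m > R" and "\<And>v. v \<in> x \<Longrightarrow> m \<le> norm (v - u)"
proof
  \<comment> \<open>Inserting \<open>R + 1\<close> keeps the set nonempty and caps its minimum, so
    the bound also covers points farther away than \<open>R + 1\<close>.\<close>
  let ?S = "insert (R + 1) ((\<lambda>v. norm (v - u)) ` (x \<inter> cball u (R + 1)))"
  have fin: "finite ?S"
    using N_lf_finite_Int[OF assms(1) bounded_cball] by auto
  have "R < norm (v - u)" if "v \<in> x" for v
    using assms(2) that by (auto simp: dist_norm norm_minus_commute disjoint_iff)
  then show "Min ?S > R"
    using fin by (subst Min_gr_iff) auto
  show "Min ?S \<le> norm (v - u)" if "v \<in> x" for v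
  proof (cases "v \<in> cball u (R + 1)")
    case True
    with fin that show ?thesis by (intro Min_le) auto
  next
    case False
    moreover have "Min ?S \<le> R + 1"
      using fin by (intro Min_le) auto
    ultimately show ?thesis
      by (auto simp: dist_norm norm_minus_commute)
  qed
qed

text \<open>An infimum of numbers exceeding \<open>R\<close> could equal \<open>R\<close>; the gap
  excludes this for locally finite configurations. In this form \<open>h_tilde\<close> is the
  indicator of a void event, which serves both its measurability and the positivity of
  \<open>F_tilde\<close>.\<close>

lemma h_tilde_eq:
  fixes x :: "(real ^ 'd) set"
  assumes "x \<in> N_lf"
  shows "h_tilde R u x = of_bool (x \<inter> cball u R = {})"
proof (cases "x \<inter> cball u R = {}")
  case True
  then obtain m where m: "m > R" "\<And>v. v \<in> x \<Longrightarrow> m \<le> norm (v - u)"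
    using N_lf_gap[OF assms] by metis
  have "ereal R < ereal m" using m by simp
  also have "ereal m \<le> conf_dist u x"
    unfolding conf_dist_def using m by (intro INF_greatest) auto
  finally show ?thesis
    using True by (simp add: h_tilde_def)
next
  case False
  then obtain v where v: "v \<in> x" "norm (v - u) \<le> R"
    by (auto simp: dist_norm norm_minus_commute)
  then have "conf_dist u x \<le> ereal R"
    unfolding conf_dist_def by (intro INF_lower2[of v]) auto
  then show ?thesis
    using False by (simp add: h_tilde_def)
qed

text \<open>For fixed \<open>x\<close> the set of \<open>u\<close> in question is open, which makes it a countable union of
  measurable rectangles.\<close>

lemma sets_disjoint_cball:
  "{(u, x). x \<in> N_lf \<and> x \<inter> cball u R = {}} \<in> sets (borel \<Otimes>\<^sub>M (N_lf_algebra :: (real ^ 'd) set measure))"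
proof -
  obtain D :: "(real ^ 'd) set" where D: "countable D"
      and dense: "\<And>Y. open Y \<Longrightarrow> Y \<noteq> {} \<Longrightarrow> \<exists>d\<in>D. d \<in> Y"
    using countable_dense_exists[where 'a = "real ^ 'd"] by metis
  \<comment> \<open>Emptiness of \<open>cball q (R + s)\<close> forces emptiness of
    \<open>cball u R\<close> for every \<open>u\<close> within \<open>s\<close> of \<open>q\<close>,
    so each rectangle lies in the set; centres from a countable dense set and rational radii exhaust
    it.\<close>
  let ?rect = "\<lambda>(q :: real ^ 'd, s). ball q s \<times> {x \<in> N_lf. card (x \<inter> cball q (R + s)) = 0}"
  have "{(u, x). x \<in> N_lf \<and> x \<inter> cball u R = {}} = (\<Union>p \<in> D \<times> \<rat>. ?rect p)" (is "?L = ?R")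
  proof (intro equalityI subsetI)
    fix p assume "p \<in> ?L"
    then obtain u x where p: "p = (u, x)" and x: "x \<in> N_lf" "x \<inter> cball u R = {}"
      by auto
    obtain m where m: "m > R" "\<And>v. v \<in> x \<Longrightarrow> m \<le> norm (v - u)"
      using N_lf_gap[OF x] by metis
    \<comment> \<open>With \<open>dist u q < s\<close>, a point of \<open>cball q (R + s)\<close>
      would lie within \<open>R + 2 * s < m\<close> of \<open>u\<close>, against the gap; hence the
      halving.\<close>
    obtain s where s: "s \<in> \<rat>" "0 < s" "s < (m - R) / 2"
      using Rats_dense_in_real[of 0 "(m - R) / 2"] m(1) by auto
    obtain q where q: "q \<in> D" "q \<in> ball u s"
      using dense[of "ball u s"] s by auto
    have "x \<inter> cball q (R + s) = {}"
    proof (rule equals0I)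
      fix v assume "v \<in> x \<inter> cball q (R + s)"
      then have "v \<in> x" "dist q v \<le> R + s" by auto
      moreover have "dist u v \<le> dist u q + dist q v" by (rule dist_triangle)
      ultimately show False
        using q(2) m(2)[of v] s(3) by (auto simp: dist_norm norm_minus_commute)
    qed
    then show "p \<in> ?R"
      using p q s x by (auto simp: dist_commute intro!: bexI[of _ q] bexI[of _ s])
  next
    fix p assume "p \<in> ?R"
    then obtain q s u x where p: "p = (u, x)" and u: "u \<in> ball q s"
        and x: "x \<in> N_lf" "card (x \<inter> cball q (R + s)) = 0"
      by auto
    have "x \<inter> cball q (R + s) = {}"
      using x(2) N_lf_finite_Int[OF x(1) bounded_cball] by (simp only: card_0_eq)
    moreover have "v \<in> cball q (R + s)" if "v \<in> cball u R" for v
      using that u dist_triangle[of q v u] by auto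
    ultimately show "p \<in> ?L"
      using p x(1) by auto
  qed
  moreover have "?rect p \<in> sets (borel \<Otimes>\<^sub>M N_lf_algebra)" for p
  proof -
    obtain q s where p: "p = (q, s)" by (cases p)
    have "(\<lambda>x. card (x \<inter> cball q (R + s))) -` {0} \<inter> space N_lf_algebra \<in> sets N_lf_algebra"
      by (rule measurable_sets[OF measurable_card_Int]) auto
    also have "(\<lambda>x. card (x \<inter> cball q (R + s))) -` {0} \<inter> space N_lf_algebra =
        {x \<in> N_lf. card (x \<inter> cball q (R + s)) = 0}"
      by (auto simp: space_N_lf_algebra)
    finally show ?thesis
      unfolding p prod.case by (intro pair_measureI) auto
  qed
  ultimately show ?thesis
    using D by (auto intro!: sets.countable_UN' countable_SIGMA countable_rat)
qed

lemma measurable_disjoint_cball: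
  fixes g :: "'a \<Rightarrow> (real ^ 'd) set"
  assumes f: "f \<in> borel_measurable A" and g: "g \<in> measurable A N_lf_algebra"
  shows "Measurable.pred A (\<lambda>a. g a \<inter> cball (f a) R = {})"
proof -
  have "(\<lambda>a. (f a, g a)) \<in> measurable A (borel \<Otimes>\<^sub>M N_lf_algebra)"
    using f g by (rule measurable_Pair)
  from measurable_sets[OF this sets_disjoint_cball[of R]]
  have "(\<lambda>a. (f a, g a)) -` {(u, x). x \<in> N_lf \<and> x \<inter> cball u R = {}} \<inter> space A \<in> sets A" .
  also have "(\<lambda>a. (f a, g a)) -` {(u, x). x \<in> N_lf \<and> x \<inter> cball u R = {}} \<inter> space A =
      {a \<in> space A. g a \<inter> cball (f a) R = {}}"
    using measurable_space[OF g] by (auto simp: space_N_lf_algebra)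
  finally show ?thesis
    by (simp add: pred_def)
qed

lemma borel_measurable_h_tilde [measurable (raw)]:
  fixes g :: "'a \<Rightarrow> (real ^ 'd) set"
  assumes f: "f \<in> borel_measurable A" and g: "g \<in> measurable A N_lf_algebra"
  shows "(\<lambda>a. h_tilde R (f a) (g a)) \<in> borel_measurable A"
proof -
  note [measurable] = measurable_disjoint_cball[OF f g, of R]
  have "(\<lambda>a. of_bool (g a \<inter> cball (f a) R = {}) :: real) \<in> borel_measurable A"
    by measurable
  then show ?thesis
    by (rule measurable_cong[THEN iffD1, rotated])
       (use measurable_space[OF g] in \<open>auto simp: h_tilde_eq space_N_lf_algebra\<close>)
qed

lemma measurable_conf_Diff [measurable (raw)]:
  fixes g :: "'a \<Rightarrow> (real ^ 'd) set"
  assumes f[measurable]: "f \<in> borel_measurable A" and g: "g \<in> measurable A N_lf_algebra"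
  shows "(\<lambda>a. g a - {f a}) \<in> measurable A N_lf_algebra"
proof (rule measurable_N_lf_algebraI)
  have N: "g a \<in> N_lf" if "a \<in> space A" for a
    using measurable_space[OF g that] by (simp add: space_N_lf_algebra)
  then show "g a - {f a} \<in> N_lf" if "a \<in> space A" for a
    using that by (simp add: N_lf_Diff)
  fix B :: "(real ^ 'd) set" assume B[measurable]: "B \<in> sets borel" and "bounded B"
  \<comment> \<open>Radius \<open>0\<close> makes the ball the singleton \<open>{f a}\<close>, so
    membership of \<open>f a\<close> in \<open>g a\<close> becomes a measurable event. Deletion
    lowers the count in \<open>B\<close> by one exactly when the point lies in both
    \<open>g a\<close> and \<open>B\<close>.\<close>
  note [measurable] = measurable_card_Int_compose[OF g B \<open>bounded B\<close>]
    measurable_disjoint_cball[OF f g, of 0]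
  have "(\<lambda>a. card (g a \<inter> B) - (if g a \<inter> cball (f a) 0 \<noteq> {} \<and> f a \<in> B then 1 else 0))
      \<in> measurable A (count_space UNIV)"
    by measurable
  then show "(\<lambda>a. card ((g a - {f a}) \<inter> B)) \<in> measurable A (count_space UNIV)"
  proof (rule measurable_cong[THEN iffD1, rotated])
    fix a assume "a \<in> space A"
    then have "finite (g a \<inter> B)"
      using N N_lf_finite_Int \<open>bounded B\<close> by blast
    moreover have "(g a - {f a}) \<inter> B = (g a \<inter> B) - {f a}"
      by auto
    ultimately show "card (g a \<inter> B) - (if g a \<inter> cball (f a) 0 \<noteq> {} \<and> f a \<in> B then 1 else 0) =
        card ((g a - {f a}) \<inter> B)"
      by (auto simp: card_Diff_singleton_if)
  qed
qed

section \<open>Measurable sums over the points of a configuration\<close>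

text \<open>Normalising the counting measure of \<open>x \<inter> C\<close> turns it into a subprobability kernel.\<close>

lemma measurable_uniform_on_conf:
  fixes C :: "(real ^ 'd) set"
  assumes C: "C \<in> sets borel" "bounded C"
  shows "(\<lambda>x. distr (uniform_count_measure (x \<inter> C)) borel (\<lambda>u. u))
    \<in> measurable N_lf_algebra (subprob_algebra borel)"
proof (rule measurable_subprob_algebra)
  \<comment> \<open>Pushing forward under the identity replaces the power set of
    \<open>x \<inter> C\<close>, which varies with \<open>x\<close>, by the fixed Borel algebra. For
    empty \<open>x \<inter> C\<close> both sides are zero because \<open>0 / 0 = 0\<close>, which is
    why the kernel is only a subprobability.\<close>
  have em: "emeasure (distr (uniform_count_measure (x \<inter> C)) borel (\<lambda>u. u)) B =
      ennreal (card (x \<inter> (C \<inter> B)) / card (x \<inter> C))"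
    if "x \<in> space N_lf_algebra" "B \<in> sets borel" for x B
  proof -
    have "finite (x \<inter> C)"
      using N_lf_finite_Int C that by (simp add: space_N_lf_algebra)
    then have "ennreal (card (x \<inter> (C \<inter> B)) / card (x \<inter> C)) =
        emeasure (uniform_count_measure (x \<inter> C)) (x \<inter> (C \<inter> B))"
      by (subst emeasure_uniform_count_measure) auto
    also have "\<dots> = emeasure (distr (uniform_count_measure (x \<inter> C)) borel (\<lambda>u. u)) B"
      using that by (subst emeasure_distr)
        (auto simp: space_uniform_count_measure sets_uniform_count_measure
          measurable_def Int_ac)
    finally show ?thesis by simp
  qed
  show "subprob_space (distr (uniform_count_measure (x \<inter> C)) borel (\<lambda>u. u))"
    if "x \<in> space N_lf_algebra" for x
    by (rule subprob_spaceI) (use em[OF that, of UNIV] in \<open>auto simp: divide_le_eq_1\<close>)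
  show "sets (distr (uniform_count_measure (x \<inter> C)) borel (\<lambda>u. u)) = sets borel" for x
    by simp
  fix B :: "(real ^ 'd) set" assume B: "B \<in> sets borel"
  note [measurable] = measurable_card_Int[OF C]
    measurable_card_Int[OF sets.Int[OF C(1) B] bounded_Int[OF disjI1[OF C(2)]]]
  have "(\<lambda>x. ennreal (card (x \<inter> (C \<inter> B)) / card (x \<inter> C))) \<in> borel_measurable N_lf_algebra"
    by measurable
  then show "(\<lambda>x. emeasure (distr (uniform_count_measure (x \<inter> C)) borel (\<lambda>u. u)) B)
      \<in> borel_measurable N_lf_algebra"
    by (rule measurable_cong[THEN iffD1, rotated]) (simp add: em B)
qed

text \<open>The sum is the cardinality times the mean of \<open>f a\<close> under the uniform
  distribution on \<open>g a \<inter> C\<close>, and integration against a measurable kernel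
  preserves measurability.\<close>

lemma borel_measurable_conf_sum:
  fixes C :: "(real ^ 'd) set" and f :: "'a \<Rightarrow> real ^ 'd \<Rightarrow> real"
  assumes C: "C \<in> sets borel" "bounded C"
    and g: "g \<in> measurable A N_lf_algebra"
    and f: "(\<lambda>(a, u). f a u) \<in> borel_measurable (A \<Otimes>\<^sub>M borel)"
  shows "(\<lambda>a. \<Sum>u \<in> g a \<inter> C. f a u) \<in> borel_measurable A"
proof -
  let ?L = "\<lambda>a. distr (uniform_count_measure (g a \<inter> C)) borel (\<lambda>u. u)"
  \<comment> \<open>Since \<open>f\<close> also depends on \<open>a\<close>, the kernel is carried
    to the fibre over \<open>a\<close>, where the jointly measurable \<open>f\<close> is a single
    integrand.\<close>
  let ?P = "\<lambda>a. distr (?L a) (A \<Otimes>\<^sub>M borel) (\<lambda>u. (a, u))"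
  have L: "?L \<in> measurable A (subprob_algebra borel)"
    using measurable_compose[OF g measurable_uniform_on_conf[OF C]] .
  have "?P \<in> measurable A (subprob_algebra (A \<Otimes>\<^sub>M borel))"
    by (rule measurable_distr2[OF _ L]) simp
  then have [measurable]: "(\<lambda>a. \<integral>(a, u). f a u \<partial>?P a) \<in> borel_measurable A"
    by (rule measurable_compose[OF _ integral_measurable_subprob_algebra[OF f]])
  note [measurable] = measurable_card_Int_compose[OF g C]
  have "(\<lambda>a. card (g a \<inter> C) * (\<integral>(a, u). f a u \<partial>?P a)) \<in> borel_measurable A"
    by measurable
  then show ?thesis
  proof (rule measurable_cong[THEN iffD1, rotated])
    fix a assume a: "a \<in> space A"
    then have fin: "finite (g a \<inter> C)"
      using N_lf_finite_Int C measurable_space[OF g] by (auto simp: space_N_lf_algebra)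
    have pair: "(\<lambda>u. (a, u)) \<in> measurable borel (A \<Otimes>\<^sub>M borel)"
      using a by simp
    have fa: "f a \<in> borel_measurable borel"
      using measurable_compose[OF pair f] by simp
    have "(\<integral>(a, u). f a u \<partial>?P a) = (\<integral>u. f a u \<partial>?L a)"
      using pair f by (subst integral_distr) auto
    also have "\<dots> = (\<integral>u. f a u \<partial>uniform_count_measure (g a \<inter> C))"
      using fa by (subst integral_distr) (auto simp: uniform_count_measure_def)
    finally show "card (g a \<inter> C) * (\<integral>(a, u). f a u \<partial>?P a) = (\<Sum>u \<in> g a \<inter> C. f a u)"
      using fin by (cases "g a \<inter> C = {}") (auto simp: integral_uniform_count_measure)
  qed
qed

text \<open>Only the finitely many points in \<open>C\<close> contribute, so the infinite sum is a
  finite one.\<close>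

lemma borel_measurable_conf_infsum:
  fixes C :: "(real ^ 'd) set" and f :: "'a \<Rightarrow> real ^ 'd \<Rightarrow> real"
  assumes C: "C \<in> sets borel" "bounded C"
    and g: "g \<in> measurable A N_lf_algebra"
    and f: "(\<lambda>(a, u). f a u) \<in> borel_measurable (A \<Otimes>\<^sub>M borel)"
    and 0: "\<And>a u. u \<notin> C \<Longrightarrow> f a u = 0"
  shows "(\<lambda>a. \<Sum>\<^sub>\<infinity>u \<in> g a. f a u) \<in> borel_measurable A"
proof (rule measurable_cong[THEN iffD1, OF _ borel_measurable_conf_sum[OF C g f]])
  fix a assume "a \<in> space A"
  then have "finite (g a \<inter> C)"
    using N_lf_finite_Int C measurable_space[OF g] by (auto simp: space_N_lf_algebra)
  then have "(\<Sum>u \<in> g a \<inter> C. f a u) = (\<Sum>\<^sub>\<infinity>u \<in> g a \<inter> C. f a u)"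
    by simp
  also have "\<dots> = (\<Sum>\<^sub>\<infinity>u \<in> g a. f a u)"
    by (rule infsum_cong_neutral) (auto simp: 0)
  finally show "(\<Sum>u \<in> g a \<inter> C. f a u) = (\<Sum>\<^sub>\<infinity>u \<in> g a. f a u)" .
qed

lemma borel_measurable_h_star [measurable (raw)]:
  fixes g :: "'a \<Rightarrow> (real ^ 'd) set"
  assumes [measurable]: "f \<in> borel_measurable A" "g \<in> measurable A N_lf_algebra"
  shows "(\<lambda>a. h_star R r (f a) (g a)) \<in> borel_measurable A"
proof -
  interpret prob_space "sphere_measure :: (real ^ 'd) measure"
    by (rule prob_space_sphere_measure)
  have [measurable_cong]: "sets (sphere_measure :: (real ^ 'd) measure) = sets borel"
    by (simp add: sphere_measure_def)
  show ?thesis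
    unfolding h_star_def by measurable
qed

subsection \<open>Measurability of the estimators\<close>

lemma is_cube_eq_cbox:
  fixes W :: "(real ^ 'd) set"
  assumes "is_cube W"
  obtains p q where "W = cbox p q"
proof -
  obtain c a where W: "W = {u. \<forall>i. \<bar>u $ i - c $ i\<bar> \<le> a}"
    using assms by (auto simp: is_cube_def)
  have "W = cbox (\<chi> i. c $ i - a) (\<chi> i. c $ i + a)"
    by (auto simp: W mem_box_cart abs_le_iff algebra_simps)
  then show thesis ..
qed

lemma closed_erode:
  assumes "closed W"
  shows "closed (erode W s)"
proof -
  \<comment> \<open>Erosion by a ball is an intersection of translates of \<open>W\<close>; the
    factor \<open>W\<close> settles the case \<open>s < 0\<close>, where the ball is empty.\<close>
  have "erode W s = W \<inter> (\<Inter>z\<in>cball 0 s. (\<lambda>u. u + z) -` W)"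
  proof (intro equalityI subsetI)
    fix u assume "u \<in> erode W s"
    then have "u \<in> W" "cball u s \<subseteq> W" by (auto simp: erode_def)
    moreover have "u + z \<in> cball u s" if "z \<in> cball 0 s" for z
      using that by (simp add: dist_norm)
    ultimately show "u \<in> W \<inter> (\<Inter>z\<in>cball 0 s. (\<lambda>u. u + z) -` W)"
      by blast
  next
    fix u assume u: "u \<in> W \<inter> (\<Inter>z\<in>cball 0 s. (\<lambda>u. u + z) -` W)"
    have "v \<in> W" if "v \<in> cball u s" for v
    proof -
      have "v - u \<in> cball 0 s"
        using that by (simp add: dist_norm norm_minus_commute)
      with u have "u + (v - u) \<in> W" by blast
      then show ?thesis by simp
    qed
    with u show "u \<in> erode W s"
      by (auto simp: erode_def)
  qed
  moreover have "closed ((\<lambda>u. u + z) -` W)" for z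
    using assms by (intro continuous_closed_vimage) (auto intro!: continuous_intros)
  ultimately show ?thesis
    using assms by (simp add: closed_Int closed_INT)
qed

lemma erode_cube:
  fixes W :: "(real ^ 'd) set"
  assumes "is_cube W"
  shows "erode W s \<in> sets borel" and "bounded (erode W s)"
proof -
  obtain p q where W: "W = cbox p q"
    using is_cube_eq_cbox[OF assms] .
  then show "erode W s \<in> sets borel"
    by (intro borel_closed closed_erode) auto
  show "bounded (erode W s)"
    using W by (intro bounded_subset[OF bounded_cbox[of p q]]) (auto simp: erode_def)
qed

lemma borel_measurable_J_hat:
  fixes W :: "(real ^ 'd) set"
  assumes "is_cube W"
  shows "J_hat R W r \<in> borel_measurable N_lf_algebra"
proof -
  note E[measurable] = erode_cube(1)[OF assms, of "2 * R"]
  have "(\<lambda>x. \<Sum>\<^sub>\<infinity>u\<in>x. indicator (erode W (2 * R)) u * h_tilde R u (x - {u}) * h_star R r u (x - {u}))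
      \<in> borel_measurable N_lf_algebra"
    by (rule borel_measurable_conf_infsum[OF erode_cube[OF assms, of "2 * R"]]) auto
  then show ?thesis
    unfolding J_hat_def[abs_def] by measurable
qed

lemma borel_measurable_beta_hat:
  fixes W :: "(real ^ 'd) set"
  assumes "is_cube W"
  shows "beta_hat R W \<in> borel_measurable N_lf_algebra"
proof -
  note E[measurable] = erode_cube(1)[OF assms, of R]
  have [measurable]: "(\<lambda>x. \<Sum>\<^sub>\<infinity>u\<in>x. indicator (erode W R) u * h_tilde R u (x - {u}))
      \<in> borel_measurable N_lf_algebra"
    by (rule borel_measurable_conf_infsum[OF erode_cube[OF assms, of R]]) auto
  show ?thesis
    unfolding beta_hat_def[abs_def] set_lebesgue_integral_def by measurable
qed

text \<open>The sum over pairs is an iterated sum over points: the window localises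
  \<open>u\<close>, the range \<open>R\<close> then localises \<open>v\<close>, and the result for
  sums over points applies twice.\<close>

lemma borel_measurable_R_hat:
  fixes W :: "(real ^ 'd) set"
  assumes "is_cube W" and [measurable]: "K \<in> borel_measurable borel"
  shows "R_hat K R b W r \<in> borel_measurable N_lf_algebra"
proof -
  let ?E = "erode W (2 * R)"
  note E[measurable] = erode_cube(1)[OF assms(1), of "2 * R"]
  obtain \<rho> where \<rho>: "?E \<subseteq> cball 0 \<rho>"
    using erode_cube(2)[OF assms(1), of "2 * R"] by (auto simp: bounded_iff subset_iff)
  \<comment> \<open>The ball contains the eroded window and all points within distance
    \<open>R\<close> of it; the absolute value covers either sign of \<open>R\<close>.\<close>
  define C :: "(real ^ 'd) set" where "C = cball 0 (\<rho> + \<bar>R\<bar>)"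
  have C: "C \<in> sets borel" "bounded C"
    by (auto simp: C_def)
  define f :: "(real ^ 'd) set \<Rightarrow> real ^ 'd \<Rightarrow> real ^ 'd \<Rightarrow> real" where
    "f x u v = indicator ?E u / norm (v - u) ^ (CARD('d) - 1) *
        h_tilde R u (x - {u, v}) * h_tilde R v (x - {u, v}) * K ((norm (v - u) - r) / b)" for x u v
  have f0: "f x u v = 0" if "norm (v - u) \<le> R" "\<not> (u \<in> C \<and> v \<in> C)" for x u v
  proof -
    have "u \<notin> ?E"
    proof
      assume "u \<in> ?E"
      then have "norm u \<le> \<rho>" using \<rho> by auto
      moreover have "norm v \<le> norm u + norm (v - u)"
        by (metis add.commute diff_add_cancel norm_triangle_ineq)
      ultimately show False
        using that by (auto simp: C_def)
    qed
    then show ?thesis by (simp add: f_def)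
  qed
  \<comment> \<open>The restriction to admissible pairs becomes a factor, which turns the index set
    into the product of \<open>x \<inter> C\<close> with itself.\<close>
  have "(\<lambda>x. \<Sum>u\<in>x \<inter> C. \<Sum>v\<in>x \<inter> C. of_bool (u \<noteq> v \<and> norm (v - u) \<le> R) * f x u v)
      \<in> borel_measurable N_lf_algebra"
  proof (rule borel_measurable_conf_sum[OF C])
    \<comment> \<open>The inner sum must be jointly measurable in the configuration and the outer
      point, so this pair serves as the parameter. Removing \<open>u\<close> and \<open>v\<close> is
      treated as two successive deletions of one point.\<close>
    have "(\<lambda>p. \<Sum>v\<in>fst p \<inter> C. of_bool (snd p \<noteq> v \<and> norm (v - snd p) \<le> R) * f (fst p) (snd p) v)
        \<in> borel_measurable (N_lf_algebra \<Otimes>\<^sub>M borel)"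
      unfolding f_def Diff_insert2[where B = "{v}" for v]
      by (rule borel_measurable_conf_sum[OF C]) measurable
    then show "(\<lambda>(x, u). \<Sum>v\<in>x \<inter> C. of_bool (u \<noteq> v \<and> norm (v - u) \<le> R) * f x u v)
        \<in> borel_measurable (N_lf_algebra \<Otimes>\<^sub>M borel)"
      by (simp add: case_prod_beta')
  qed auto
  then have [measurable]: "(\<lambda>x. \<Sum>\<^sub>\<infinity>(u, v)\<in>{(u, v). u \<in> x \<and> v \<in> x \<and> u \<noteq> v \<and> norm (v - u) \<le> R}. f x u v)
      \<in> borel_measurable N_lf_algebra"
  proof (rule measurable_cong[THEN iffD1, rotated])
    fix x :: "(real ^ 'd) set" assume "x \<in> space N_lf_algebra"
    then have fin: "finite (x \<inter> C)"
      using N_lf_finite_Int C by (simp add: space_N_lf_algebra)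
    have "(\<Sum>u\<in>x \<inter> C. \<Sum>v\<in>x \<inter> C. of_bool (u \<noteq> v \<and> norm (v - u) \<le> R) * f x u v) =
        (\<Sum>(u, v)\<in>(x \<inter> C) \<times> (x \<inter> C). of_bool (u \<noteq> v \<and> norm (v - u) \<le> R) * f x u v)"
      by (rule sum.cartesian_product)
    also have "\<dots> =
        (\<Sum>\<^sub>\<infinity>(u, v)\<in>(x \<inter> C) \<times> (x \<inter> C). of_bool (u \<noteq> v \<and> norm (v - u) \<le> R) * f x u v)"
      using fin by simp
    \<comment> \<open>Admissible pairs with a point outside \<open>C\<close> contribute zero by
      \<open>f0\<close>, and inadmissible pairs inside contribute zero by the factor.\<close>
    also have "\<dots> = (\<Sum>\<^sub>\<infinity>(u, v)\<in>{(u, v). u \<in> x \<and> v \<in> x \<and> u \<noteq> v \<and> norm (v - u) \<le> R}. f x u v)"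
      by (rule infsum_cong_neutral) (use f0 in auto)
    finally show "(\<Sum>u\<in>x \<inter> C. \<Sum>v\<in>x \<inter> C. of_bool (u \<noteq> v \<and> norm (v - u) \<le> R) * f x u v) =
        (\<Sum>\<^sub>\<infinity>(u, v)\<in>{(u, v). u \<in> x \<and> v \<in> x \<and> u \<noteq> v \<and> norm (v - u) \<le> R}. f x u v)" .
  qed
  show ?thesis
    unfolding R_hat_def[abs_def] f_def[symmetric] by measurable
qed

subsection \<open>Positivity of void probabilities\<close>

text \<open>Applied to \<open>h u x = 1(u \<in> B, card (x \<inter> B) = n)\<close>, the defining equation of the conditional
  intensity shows that if \<open>card (X \<inter> B) = n\<close> has probability zero then so has
  \<open>card (X \<inter> B) = n + 1\<close>; hence \<open>n = 0\<close> must have positive probability.\<close>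

lemma void_probability_pos:
  fixes B :: "(real ^ 'd) set"
  assumes pp: "point_process M X" and pap: "papangelou M X l"
    and B: "B \<in> sets borel" "bounded B"
  shows "\<not> (AE \<omega> in M. X \<omega> \<inter> B \<noteq> {})"
proof
  assume void: "AE \<omega> in M. X \<omega> \<inter> B \<noteq> {}"
  interpret prob_space M
    using pp by (simp add: point_process_def)
  have X: "X \<in> measurable M N_lf_algebra"
    using pp by (simp add: point_process_def)
  have fin: "finite (X \<omega> \<inter> B)" if "\<omega> \<in> space M" for \<omega>
    using measurable_space[OF X that] N_lf_finite_Int B by (simp add: space_N_lf_algebra)
  note [measurable] = B(1) measurable_card_Int[OF B] measurable_card_Int_compose[OF X B]
  have "AE \<omega> in M. card (X \<omega> \<inter> B) \<noteq> n" for n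
  proof (induction n)
    case 0
    show ?case
      using void AE_space by eventually_elim (simp add: fin)
  next
    case (Suc n)
    define h :: "real ^ 'd \<Rightarrow> (real ^ 'd) set \<Rightarrow> ennreal" where
      "h u x = indicator B u * of_bool (card (x \<inter> B) = n)" for u x
    \<comment> \<open>By the induction hypothesis the event that \<open>B\<close> holds exactly
      \<open>n\<close> points is null, so the right-hand side of the defining equation
      vanishes.\<close>
    have zero: "(\<integral>\<^sup>+ \<omega>. h u (X \<omega>) * ennreal (l u (X \<omega>)) \<partial>M) = 0" for u
      by (subst nn_integral_cong_AE[where v = "\<lambda>_. 0"])
         (use Suc in \<open>eventually_elim, simp add: h_def\<close>, simp)
    have "(\<lambda>(u, x). h u x) \<in> borel_measurable (borel \<Otimes>\<^sub>M N_lf_algebra)"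
      unfolding h_def by measurable
    then have "(\<integral>\<^sup>+ \<omega>. (\<integral>\<^sup>+ u. h u (X \<omega> - {u}) \<partial>count_space (X \<omega>)) \<partial>M) = 0"
      using pap by (simp add: papangelou_def zero)
    \<comment> \<open>If \<open>B\<close> holds \<open>n + 1\<close> points, deleting any of them
      leaves \<open>n\<close>, so each contributes one; for every other count no point
      contributes.\<close>
    also have "(\<integral>\<^sup>+ \<omega>. (\<integral>\<^sup>+ u. h u (X \<omega> - {u}) \<partial>count_space (X \<omega>)) \<partial>M) =
        (\<integral>\<^sup>+ \<omega>. of_nat (Suc n) * of_bool (card (X \<omega> \<inter> B) = Suc n) \<partial>M)"
    proof (rule nn_integral_cong)
      fix \<omega> assume \<omega>: "\<omega> \<in> space M"
      have "h u (X \<omega> - {u}) = of_bool (card (X \<omega> \<inter> B) = Suc n) * indicator (X \<omega> \<inter> B) u"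
        if "u \<in> X \<omega>" for u
      proof (cases "u \<in> B")
        case True
        then have "(X \<omega> - {u}) \<inter> B = (X \<omega> \<inter> B) - {u}" and u: "u \<in> X \<omega> \<inter> B"
          using that by auto
        then have "card (X \<omega> \<inter> B) = Suc (card ((X \<omega> - {u}) \<inter> B))"
          using card.remove[OF fin[OF \<omega>] u] by simp
        then show ?thesis
          using True that by (simp add: h_def)
      qed (simp add: h_def)
      then have "(\<integral>\<^sup>+ u. h u (X \<omega> - {u}) \<partial>count_space (X \<omega>)) =
          (\<integral>\<^sup>+ u. of_bool (card (X \<omega> \<inter> B) = Suc n) * indicator (X \<omega> \<inter> B) u \<partial>count_space (X \<omega>))"
        by (intro nn_integral_cong) auto
      also have "\<dots> = of_bool (card (X \<omega> \<inter> B) = Suc n) * of_nat (card (X \<omega> \<inter> B))"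
        using fin[OF \<omega>] by (subst nn_integral_cmult_indicator) (auto simp: emeasure_count_space_finite)
      finally show "(\<integral>\<^sup>+ u. h u (X \<omega> - {u}) \<partial>count_space (X \<omega>)) =
          of_nat (Suc n) * of_bool (card (X \<omega> \<inter> B) = Suc n)"
        by auto
    qed
    finally have "(\<integral>\<^sup>+ \<omega>. of_nat (Suc n) * of_bool (card (X \<omega> \<inter> B) = Suc n) \<partial>M) = 0" .
    then have "AE \<omega> in M. (of_nat (Suc n) :: ennreal) * of_bool (card (X \<omega> \<inter> B) = Suc n) = 0"
      by (subst (asm) nn_integral_0_iff_AE) auto
    then show ?case
      by eventually_elim (auto simp del: of_nat_Suc)
  qed
  \<comment> \<open>The count is always some natural number; excluding all countably many values at
    once would make the whole probability space null.\<close>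
  then have "AE \<omega> in M. \<forall>n. card (X \<omega> \<inter> B) \<noteq> n"
    by (subst AE_all_countable) blast
  then show False
    by (auto simp: AE_False)
qed

text \<open>Each value of \<open>F_tilde\<close> is the void probability of a union of two balls,
  hence strictly positive, and its mean over the sphere stays positive. This keeps the limit of the
  denominator away from zero.\<close>

lemma J_fun_pos:
  fixes X :: "'w \<Rightarrow> (real ^ 'd) set"
  assumes pp: "point_process M X" and pap: "papangelou M X l"
  shows "J_fun M X R r > 0"
proof -
  interpret prob_space M
    using pp by (simp add: point_process_def)
  have X[measurable]: "X \<in> measurable M N_lf_algebra"
    using pp by (simp add: point_process_def)
  have hh: "0 \<le> h_tilde R u x * h_tilde R v x" "h_tilde R u x * h_tilde R v x \<le> 1"
    for u v :: "real ^ 'd" and x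
    by (auto simp: h_tilde_def)
  have int: "integrable M (\<lambda>\<omega>. h_tilde R u (X \<omega>) * h_tilde R v (X \<omega>))" for u v
    by (rule integrable_const_bound[where B = 1]) (use hh in \<open>auto simp: abs_of_nonneg\<close>)
  have F_pos: "F_tilde M X R u v > 0" for u v
  proof -
    have "\<not> (AE \<omega> in M. h_tilde R u (X \<omega>) * h_tilde R v (X \<omega>) = 0)"
    proof
      assume "AE \<omega> in M. h_tilde R u (X \<omega>) * h_tilde R v (X \<omega>) = 0"
      then have "AE \<omega> in M. X \<omega> \<inter> (cball u R \<union> cball v R) \<noteq> {}"
        using AE_space
      proof eventually_elim
        case (elim \<omega>)
        then have "X \<omega> \<in> N_lf"
          using measurable_space[OF X] by (simp add: space_N_lf_algebra)
        with elim show ?case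
          by (auto simp: h_tilde_eq split: if_splits)
      qed
      then show False
        using void_probability_pos[OF pp pap, of "cball u R \<union> cball v R"] by auto
    qed
    moreover have "F_tilde M X R u v \<ge> 0"
      unfolding F_tilde_def by (rule integral_nonneg_AE) (simp add: hh)
    ultimately show ?thesis
      using integral_nonneg_eq_0_iff_AE[OF int, of u v] hh
      by (auto simp: F_tilde_def less_le)
  qed
  have F_le: "F_tilde M X R u v \<le> 1" for u v
    unfolding F_tilde_def by (rule integral_le_const[OF int]) (simp add: hh)
  interpret S: prob_space "sphere_measure :: (real ^ 'd) measure"
    by (rule prob_space_sphere_measure)
  have [measurable_cong]: "sets (sphere_measure :: (real ^ 'd) measure) = sets borel"
    by (simp add: sphere_measure_def)
  have [measurable]: "(\<lambda>v. F_tilde M X R 0 (r *\<^sub>R v)) \<in> borel_measurable sphere_measure"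
    unfolding F_tilde_def by measurable
  have int: "integrable sphere_measure (\<lambda>v. F_tilde M X R 0 (r *\<^sub>R v))"
    by (rule S.integrable_const_bound[where B = 1]) (auto simp: F_le F_pos less_imp_le)
  have "(\<integral>v. 0 \<partial>(sphere_measure :: (real ^ 'd) measure)) < J_fun M X R r"
    unfolding J_fun_def
    by (rule S.integral_less_AE_space[OF _ int]) (auto simp: F_pos S.emeasure_space_1)
  then show ?thesis by simp
qed

subsection \<open>Products of convergent random variables\<close>

text \<open>The indicators tend to zero almost surely and are bounded by one, so dominated
  convergence applies. This serves both for deviations of an almost surely convergent factor and for
  indices where two sequences differ.\<close>

lemma (in prob_space) prob_eventually_not_tendsto_0:
  assumes meas: "\<And>n. {\<omega> \<in> space M. P n \<omega>} \<in> events"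
    and ae: "AE \<omega> in M. eventually (\<lambda>n. \<not> P n \<omega>) sequentially"
  shows "(\<lambda>n. prob {\<omega> \<in> space M. P n \<omega>}) \<longlonglongrightarrow> 0"
proof -
  have "(\<lambda>n. \<integral>\<omega>. indicator {\<omega> \<in> space M. P n \<omega>} \<omega> \<partial>M) \<longlonglongrightarrow> (\<integral>\<omega>. (0 :: real) \<partial>M)"
  proof (rule integral_dominated_convergence[where w = "\<lambda>_. 1"])
    show "AE \<omega> in M. (\<lambda>n. indicator {\<omega> \<in> space M. P n \<omega>} \<omega> :: real) \<longlonglongrightarrow> 0"
      using ae
    proof eventually_elim
      case (elim \<omega>)
      then have "eventually (\<lambda>n. indicator {\<omega> \<in> space M. P n \<omega>} \<omega> = (0 :: real)) sequentially"
        by eventually_elim simp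
      then show ?case
        by (rule tendsto_eventually)
    qed
  qed (use meas in \<open>auto split: split_indicator\<close>)
  then show ?thesis
    using meas by simp
qed

text \<open>The error splits as
  \<open>(Y n \<omega> - c) * D n \<omega> + c * (D n \<omega> - d)\<close>, and it is small unless
  one of the two factors deviates from its limit.\<close>

lemma (in prob_space) converges_in_prob_mult_as:
  assumes [measurable]: "\<And>n. Y n \<in> borel_measurable M" "\<And>n. D n \<in> borel_measurable M"
    and Y: "converges_in_prob M Y c" and D: "converges_as M D d"
  shows "converges_in_prob M (\<lambda>n \<omega>. Y n \<omega> * D n \<omega>) (c * d)"
  unfolding converges_in_prob_def
proof (intro allI impI)
  fix \<epsilon> :: real assume \<epsilon>: "\<epsilon> > 0"
  \<comment> \<open>The cap \<open>\<eta> \<le> 1\<close> bounds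
    \<open>\<bar>D n \<omega>\<bar>\<close> by \<open>\<bar>d\<bar> + 1\<close>, and each part of
    the error is then at most \<open>\<epsilon> / 2\<close>; adding one keeps the divisors positive
    when \<open>c\<close> or \<open>d\<close> is zero.\<close>
  define \<eta> where "\<eta> = min 1 (\<epsilon> / (2 * (\<bar>c\<bar> + 1)))"
  define \<epsilon>' where "\<epsilon>' = \<epsilon> / (2 * (\<bar>d\<bar> + 1))"
  have pos: "\<eta> > 0" "\<epsilon>' > 0"
    using \<epsilon> by (auto simp: \<eta>_def \<epsilon>'_def)
  have half: "\<epsilon> / (2 * (\<bar>y\<bar> + 1)) * (\<bar>y\<bar> + 1) = \<epsilon> / 2" for y :: real
  proof -
    have "\<bar>y\<bar> + 1 > 0" by linarith
    then show ?thesis by (metis less_irrefl nonzero_eq_divide_eq divide_divide_eq_left)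
  qed
  let ?A = "\<lambda>n. {\<omega> \<in> space M. \<bar>Y n \<omega> - c\<bar> > \<epsilon>'}"
  let ?B = "\<lambda>n. {\<omega> \<in> space M. \<bar>D n \<omega> - d\<bar> > \<eta>}"
  have "{\<omega> \<in> space M. \<bar>Y n \<omega> * D n \<omega> - c * d\<bar> > \<epsilon>} \<subseteq> ?A n \<union> ?B n" for n
  proof (intro subsetI, rule ccontr)
    fix \<omega> assume \<omega>: "\<omega> \<in> {\<omega> \<in> space M. \<bar>Y n \<omega> * D n \<omega> - c * d\<bar> > \<epsilon>}" and "\<omega> \<notin> ?A n \<union> ?B n"
    then have le: "\<bar>Y n \<omega> - c\<bar> \<le> \<epsilon>'" "\<bar>D n \<omega> - d\<bar> \<le> \<eta>" by auto
    have "Y n \<omega> * D n \<omega> - c * d = (Y n \<omega> - c) * D n \<omega> + c * (D n \<omega> - d)"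
      by (simp add: algebra_simps)
    then have "\<bar>Y n \<omega> * D n \<omega> - c * d\<bar> \<le> \<bar>Y n \<omega> - c\<bar> * \<bar>D n \<omega>\<bar> + \<bar>c\<bar> * \<bar>D n \<omega> - d\<bar>"
      using abs_triangle_ineq by (metis abs_mult)
    also have "\<dots> \<le> \<epsilon>' * (\<bar>d\<bar> + 1) + (\<bar>c\<bar> + 1) * (\<epsilon> / (2 * (\<bar>c\<bar> + 1)))"
      using le pos by (intro add_mono mult_mono) (auto simp: \<eta>_def)
    also have "\<dots> = \<epsilon>"
      unfolding \<epsilon>'_def mult.commute[of "\<bar>c\<bar> + 1"] half by simp
    finally show False using \<omega> by simp
  qed
  then have le: "prob {\<omega> \<in> space M. \<bar>Y n \<omega> * D n \<omega> - c * d\<bar> > \<epsilon>} \<le> prob (?A n) + prob (?B n)" for n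
    by (intro order_trans[OF finite_measure_mono measure_Un_le]) auto
  have "(\<lambda>n. prob (?B n)) \<longlonglongrightarrow> 0"
  proof (rule prob_eventually_not_tendsto_0)
    show "AE \<omega> in M. eventually (\<lambda>n. \<not> \<bar>D n \<omega> - d\<bar> > \<eta>) sequentially"
      using D[unfolded converges_as_def]
    proof eventually_elim
      case (elim \<omega>)
      from tendstoD[OF this pos(1)] show ?case
        by eventually_elim (simp add: dist_real_def)
    qed
  qed auto
  moreover have "(\<lambda>n. prob (?A n)) \<longlonglongrightarrow> 0"
    using Y pos by (simp add: converges_in_prob_def)
  ultimately have "(\<lambda>n. prob (?A n) + prob (?B n)) \<longlonglongrightarrow> 0"
    using tendsto_add[of _ "0 :: real" _ _ 0] by simp
  then show "(\<lambda>n. prob {\<omega> \<in> space M. \<bar>Y n \<omega> * D n \<omega> - c * d\<bar> > \<epsilon>}) \<longlonglongrightarrow> 0"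
    by (rule tendsto_sandwich[OF _ _ tendsto_const, rotated 2]) (auto simp: le)
qed

text \<open>A deviation of \<open>Z n\<close> forces a deviation of \<open>Y n\<close> or a
  disagreement of the two, and disagreement has vanishing probability. The index from which they
  agree may depend on the sample point.\<close>

lemma (in prob_space) converges_in_prob_eventually_eq:
  assumes [measurable]: "\<And>n. Y n \<in> borel_measurable M" "\<And>n. Z n \<in> borel_measurable M"
    and Y: "converges_in_prob M Y c"
    and eq: "AE \<omega> in M. eventually (\<lambda>n. Y n \<omega> = Z n \<omega>) sequentially"
  shows "converges_in_prob M Z c"
  unfolding converges_in_prob_def
proof (intro allI impI)
  fix \<epsilon> :: real assume \<epsilon>: "\<epsilon> > 0"
  let ?A = "\<lambda>n. {\<omega> \<in> space M. \<bar>Y n \<omega> - c\<bar> > \<epsilon>}"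
  let ?B = "\<lambda>n. {\<omega> \<in> space M. Y n \<omega> \<noteq> Z n \<omega>}"
  have le: "prob {\<omega> \<in> space M. \<bar>Z n \<omega> - c\<bar> > \<epsilon>} \<le> prob (?A n) + prob (?B n)" for n
    by (rule order_trans[OF finite_measure_mono measure_Un_le]) auto
  have "(\<lambda>n. prob (?B n)) \<longlonglongrightarrow> 0"
    using eq by (intro prob_eventually_not_tendsto_0) auto
  moreover have "(\<lambda>n. prob (?A n)) \<longlonglongrightarrow> 0"
    using Y \<epsilon> by (simp add: converges_in_prob_def)
  ultimately have "(\<lambda>n. prob (?A n) + prob (?B n)) \<longlonglongrightarrow> 0"
    using tendsto_add[of _ "0 :: real" _ _ 0] by simp
  then show "(\<lambda>n. prob {\<omega> \<in> space M. \<bar>Z n \<omega> - c\<bar> > \<epsilon>}) \<longlonglongrightarrow> 0"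
    by (rule tendsto_sandwich[OF _ _ tendsto_const, rotated 2]) (auto simp: le)
qed

text \<open>Multiplying by \<open>D n\<close> undoes the division except where \<open>D n\<close>
  vanishes; as its limit is nonzero, almost surely this happens for only finitely many
  \<open>n\<close>.\<close>

lemma (in prob_space) convergence_divide_iff:
  assumes [measurable]: "\<And>n. Y n \<in> borel_measurable M" "\<And>n. D n \<in> borel_measurable M"
    and D: "converges_as M D d" and "d \<noteq> 0"
  shows "converges_in_prob M (\<lambda>n \<omega>. Y n \<omega> / D n \<omega>) c \<longleftrightarrow> converges_in_prob M Y (d * c)"
    and "converges_as M (\<lambda>n \<omega>. Y n \<omega> / D n \<omega>) c \<longleftrightarrow> converges_as M Y (d * c)"
proof -
  have inv: "converges_as M (\<lambda>n \<omega>. inverse (D n \<omega>)) (inverse d)"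
    using D unfolding converges_as_def
    by eventually_elim (use \<open>d \<noteq> 0\<close> in \<open>auto intro: tendsto_inverse\<close>)
  have eq: "AE \<omega> in M. eventually (\<lambda>n. Y n \<omega> / D n \<omega> * D n \<omega> = Y n \<omega>) sequentially"
    using D unfolding converges_as_def
  proof eventually_elim
    case (elim \<omega>)
    from tendsto_imp_eventually_ne[OF this \<open>d \<noteq> 0\<close>] show ?case
      by eventually_elim simp
  qed
  show "converges_in_prob M (\<lambda>n \<omega>. Y n \<omega> / D n \<omega>) c \<longleftrightarrow> converges_in_prob M Y (d * c)"
  proof
    assume "converges_in_prob M (\<lambda>n \<omega>. Y n \<omega> / D n \<omega>) c"
    then have "converges_in_prob M (\<lambda>n \<omega>. Y n \<omega> / D n \<omega> * D n \<omega>) (c * d)"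
      by (intro converges_in_prob_mult_as D) auto
    then show "converges_in_prob M Y (d * c)"
      unfolding mult.commute[of d c]
      by (rule converges_in_prob_eventually_eq[rotated 2]) (use eq in auto)
  next
    assume "converges_in_prob M Y (d * c)"
    \<comment> \<open>No exceptional indices arise in this direction: since
      \<open>inverse 0 = 0\<close>, a quotient is the product with the inverse for every
      denominator.\<close>
    then have "converges_in_prob M (\<lambda>n \<omega>. Y n \<omega> * inverse (D n \<omega>)) (d * c * inverse d)"
      by (intro converges_in_prob_mult_as inv) auto
    then show "converges_in_prob M (\<lambda>n \<omega>. Y n \<omega> / D n \<omega>) c"
      using \<open>d \<noteq> 0\<close> by (simp add: divide_inverse mult.commute[of d c] mult.assoc)
  qed
  show "converges_as M (\<lambda>n \<omega>. Y n \<omega> / D n \<omega>) c \<longleftrightarrow> converges_as M Y (d * c)"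
  proof
    assume "converges_as M (\<lambda>n \<omega>. Y n \<omega> / D n \<omega>) c"
    then show "converges_as M Y (d * c)"
      using D eq unfolding converges_as_def
    proof eventually_elim
      case (elim \<omega>)
      then have "(\<lambda>n. Y n \<omega> / D n \<omega> * D n \<omega>) \<longlonglongrightarrow> c * d"
        by (intro tendsto_mult)
      then show ?case
        using elim(3) by (simp add: tendsto_cong mult.commute)
    qed
  next
    assume "converges_as M Y (d * c)"
    then show "converges_as M (\<lambda>n \<omega>. Y n \<omega> / D n \<omega>) c"
      using D unfolding converges_as_def
    proof eventually_elim
      case (elim \<omega>)
      then have "(\<lambda>n. Y n \<omega> / D n \<omega>) \<longlonglongrightarrow> d * c / d"
        using \<open>d \<noteq> 0\<close> by (intro tendsto_divide)
      then show ?case using \<open>d \<noteq> 0\<close> by simp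
    qed
  qed
qed

section \<open>The equivalence for the estimators\<close>

theorem proposition1:
  fixes M :: "'w measure" and X :: "'w \<Rightarrow> (real ^ 'd) set"
    and \<alpha> :: nat and r R \<beta> :: real and \<gamma> K :: "real \<Rightarrow> real"
    and b :: "nat \<Rightarrow> real" and W :: "nat \<Rightarrow> (real ^ 'd) set"
  assumes "\<alpha> \<ge> 1" and "0 < R" and "0 < r" and "r \<le> R" and "0 < \<beta>"
    and "\<And>t. 0 \<le> t \<Longrightarrow> t \<le> R \<Longrightarrow> \<gamma> t > 0"
    and "\<And>t. t > R \<Longrightarrow> \<gamma> t = 0"
    and "point_process M X" and "stationary M X" and "isotropic M X"
    and "papangelou M X (pairwise_intensity \<beta> \<gamma>)"
    and "growing_cubes W" and "\<And>n. vol (erode (W n) (2 * R)) > 0"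
    and "kernel_condition \<alpha> K b W R"
    and "\<exists>\<delta>>0. bounded_continuous_derivative_on \<alpha> (\<lambda>t. J_fun M X R t * exp (- \<gamma> t))
           {r - \<delta><..<r + \<delta>}"
    and standing_J: "converges_as M (\<lambda>n \<omega>. J_hat R (W n) r (X \<omega>)) (\<beta> * J_fun M X R r)"
    and standing_beta: "converges_as M (\<lambda>n \<omega>. beta_hat R (W n) (X \<omega>)) \<beta>"
  shows "(converges_in_prob M (\<lambda>n \<omega>. Phi_hat K R (b n) (W n) r (X \<omega>)) (exp (- \<gamma> r)) \<longleftrightarrow>
          converges_in_prob M (\<lambda>n \<omega>. R_hat K R (b n) (W n) r (X \<omega>))
           (\<beta>\<^sup>2 * J_fun M X R r * exp (- \<gamma> r))) \<and>
         (converges_as M (\<lambda>n \<omega>. Phi_hat K R (b n) (W n) r (X \<omega>)) (exp (- \<gamma> r)) \<longleftrightarrow>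
          converges_as M (\<lambda>n \<omega>. R_hat K R (b n) (W n) r (X \<omega>))
           (\<beta>\<^sup>2 * J_fun M X R r * exp (- \<gamma> r)))"
proof -
  interpret prob_space M
    using \<open>point_process M X\<close> by (simp add: point_process_def)
  have X: "X \<in> measurable M N_lf_algebra"
    using \<open>point_process M X\<close> by (simp add: point_process_def)
  have cube: "is_cube (W n)" for n
    using \<open>growing_cubes W\<close> by (simp add: growing_cubes_def)
  \<comment> \<open>Integrability of the kernel yields its Borel measurability, on which that of
    \<open>R_hat\<close> rests.\<close>
  have "has_bochner_integral lborel K 1"
    using \<open>kernel_condition \<alpha> K b W R\<close> by (simp add: kernel_condition_def)
  then have "K \<in> borel_measurable borel"
    using borel_measurable_has_bochner_integral by fastforce
  note R_meas = measurable_compose[OF X borel_measurable_R_hat[OF cube this]]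
  have [measurable]: "(\<lambda>\<omega>. beta_hat R (W n) (X \<omega>)) \<in> borel_measurable M"
    "(\<lambda>\<omega>. J_hat R (W n) r (X \<omega>)) \<in> borel_measurable M" for n
    using measurable_compose[OF X borel_measurable_beta_hat[OF cube]]
      measurable_compose[OF X borel_measurable_J_hat[OF cube]] by auto
  have D_meas: "(\<lambda>\<omega>. beta_hat R (W n) (X \<omega>) * J_hat R (W n) r (X \<omega>)) \<in> borel_measurable M" for n
    by measurable
  have D: "converges_as M (\<lambda>n \<omega>. beta_hat R (W n) (X \<omega>) * J_hat R (W n) r (X \<omega>))
      (\<beta> * (\<beta> * J_fun M X R r))"
    using standing_beta standing_J unfolding converges_as_def
    by eventually_elim (rule tendsto_mult)
  have "\<beta> * (\<beta> * J_fun M X R r) \<noteq> 0"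
    using J_fun_pos[OF \<open>point_process M X\<close> \<open>papangelou M X (pairwise_intensity \<beta> \<gamma>)\<close>, of R r] \<open>0 < \<beta>\<close>
    by simp
  \<comment> \<open>\<open>Phi_hat\<close> is by definition \<open>R_hat\<close> over this
    denominator, and the limit of the denominator times \<open>exp (- \<gamma> r)\<close> is the
    stated limit of \<open>R_hat\<close>.\<close>
  from convergence_divide_iff[OF R_meas D_meas D this, where c = "exp (- \<gamma> r)"]
  show ?thesis
    by (simp add: Phi_hat_def power2_eq_square mult.assoc)
qed

end
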